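(* Let $n\ge 1$ and let $\Gamma_{2n}$ be the bipartite graph on $[2n]$ with $2i-1$ adjacent to $2j$ iff $i\le j$. For every $\pi \in \Pi_{\Gamma_{2n}}$, $$(-1)^{|\pi|}\mu_{\Pi_{\Gamma_{2n}}}(\hat{0},\pi) = |\{\sigma \in \mathcal{D}_{2n} : \mathrm{cyc}(\sigma) = \pi\}|,$$ where $|\pi|$ is the number of blocks of $\pi$. Consequently, for the arrangement $\mathcal H_{2n-1}=\{x_i-x_j=y_i:1\le i<j\le n+1\}$ in $\mathbb R^{2n+2}$, $$\chi_{\mathcal L(\mathcal H_{2n-1})}(t) = \sum_{k=1}^{2n} s_D(2n,k)\, t^{k-1},$$ where $(-1)^{k}s_D(2n,k)$ is the number of D-permutations of $[2n]$ with exactly $k$ cycles.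
   Context: The bond lattice $\Pi_G$ of a graph $G$ on $[N]$ is the poset of partitions of $[N]$ whose blocks induce connected subgraphs, ordered by refinement, with minimum $\hat 0$ the partition into singletons. $\mathcal L(\mathcal A)$ is the intersection lattice of an arrangement (nonempty intersections ordered by reverse inclusion); for a ranked poset $P$ of length $r$ with minimum $\hat 0$, $\chi_P(t)=\sum_{x\in P}\mu_P(\hat0,x)t^{r-\mathrm{rk}(x)}$. A D-permutation of $[2n]$ is a permutation $\sigma$ with $i\le\sigma(i)$ for odd $i$ and $i\ge\sigma(i)$ for even $i$; $\mathcal D_{2n}$ is the set of these. The cycle support $\mathrm{cyc}(\sigma)$ of a permutation is the set partition whose blocks are the element sets of the cycles of $\sigma$. *)

theory Defs
  imports
    "HOL-Library.Disjoint_Sets"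
    "HOL-Computational_Algebra.Polynomial"
    "HOL-Combinatorics.Permutations"
    "HOL-Combinatorics.Orbits"
    "Graph_Theory.Graph_Theory"
    "Jordan_Normal_Form.Matrix"
begin

section \<open>Finite posets\<close>

text \<open>A poset is given by a carrier set \<open>P\<close> and an order predicate \<open>leq\<close>, of which only
  the restriction to \<open>P\<close> matters.\<close>

definition finite_poset :: "'a set \<Rightarrow> ('a \<Rightarrow> 'a \<Rightarrow> bool) \<Rightarrow> bool" where
  "finite_poset P leq \<longleftrightarrow> finite P \<and> partial_order_on P (relation_of leq P)"

text \<open>The usual recursion for the Moebius function. The value \<open>0\<close> outside of finite posets is
  a dummy that makes the function total; for \<open>x \<le> y\<close> failing, \<open>0\<close> is the standard
  convention.\<close>

function moebius :: "'a set \<Rightarrow> ('a \<Rightarrow> 'a \<Rightarrow> bool) \<Rightarrow> 'a \<Rightarrow> 'a \<Rightarrow> int" where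
  "moebius P leq x y =
     (if finite_poset P leq \<and> x \<in> P \<and> y \<in> P \<and> leq x y
      then if x = y then 1
           else - (\<Sum>z \<in> {z \<in> P. leq x z \<and> leq z y \<and> z \<noteq> y}. moebius P leq x z)
      else 0)"
  by pat_completeness auto
termination
proof (relation "measure (\<lambda>(P, leq, x, y). card {z \<in> P. leq z y})")
  show "wf (measure (\<lambda>(P :: 'a set, leq, x :: 'a, y). card {z \<in> P. leq z y}))"
    by simp
next
  fix P :: "'a set" and leq x y z
  assume 1: "finite_poset P leq \<and> x \<in> P \<and> y \<in> P \<and> leq x y"
    and z: "z \<in> {z \<in> P. leq x z \<and> leq z y \<and> z \<noteq> y}"
  from 1 have fin: "finite P" and refl: "\<And>a. a \<in> P \<Longrightarrow> leq a a"
    and trans: "\<And>a b c. a \<in> P \<Longrightarrow> b \<in> P \<Longrightarrow> c \<in> P \<Longrightarrow> leq a b \<Longrightarrow> leq b c \<Longrightarrow> leq a c"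
    and antisym: "\<And>a b. a \<in> P \<Longrightarrow> b \<in> P \<Longrightarrow> leq a b \<Longrightarrow> leq b a \<Longrightarrow> a = b"
    by (auto simp: finite_poset_def partial_order_on_def preorder_on_def relation_of_def
        refl_on_def antisym_def trans_def)
  have "{w \<in> P. leq w z} \<subset> {w \<in> P. leq w y}"
  proof
    show "{w \<in> P. leq w z} \<subseteq> {w \<in> P. leq w y}"
      using 1 z trans by blast
    show "{w \<in> P. leq w z} \<noteq> {w \<in> P. leq w y}"
      using 1 z refl antisym by blast
  qed
  then have "card {w \<in> P. leq w z} < card {w \<in> P. leq w y}"
    using fin by (intro psubset_card_mono) auto
  then show "((P, leq, x, z), (P, leq, x, y)) \<in> measure (\<lambda>(P, leq, x, y). card {z \<in> P. leq z y})"
    by simp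
qed

declare moebius.simps [simp del]

definition poset_bot :: "'a set \<Rightarrow> ('a \<Rightarrow> 'a \<Rightarrow> bool) \<Rightarrow> 'a" where
  "poset_bot P leq = (THE b. b \<in> P \<and> (\<forall>x \<in> P. leq b x))"

text \<open>A chain of \<open>k + 1\<close> elements has length \<open>k\<close>. The rank of \<open>x\<close> is the length of the
  longest chain in the principal ideal of \<open>x\<close>.\<close>

definition poset_length :: "'a set \<Rightarrow> ('a \<Rightarrow> 'a \<Rightarrow> bool) \<Rightarrow> nat" where
  "poset_length P leq = Max ((\<lambda>C. card C - 1) ` Chains (relation_of leq P))"

definition poset_rank :: "'a set \<Rightarrow> ('a \<Rightarrow> 'a \<Rightarrow> bool) \<Rightarrow> 'a \<Rightarrow> nat" where
  "poset_rank P leq x = poset_length {z \<in> P. leq z x} leq"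

definition characteristic_poly :: "'a set \<Rightarrow> ('a \<Rightarrow> 'a \<Rightarrow> bool) \<Rightarrow> int poly" where
  "characteristic_poly P leq =
     (\<Sum>x \<in> P. Polynomial.monom (moebius P leq (poset_bot P leq) x)
                 (poset_length P leq - poset_rank P leq x))"

section \<open>Bond lattices\<close>

text \<open>Undirected graphs are symmetric loop-free digraphs, as in the session \<open>Graph_Theory\<close>.
  The order on the bond lattice of \<open>G\<close> is \<^term>\<open>refines (pverts G)\<close>.\<close>

definition bond_lattice :: "'a pair_pre_digraph \<Rightarrow> 'a set set set" where
  "bond_lattice G =
     {\<pi>. partition_on (pverts G) \<pi> \<and> (\<forall>B \<in> \<pi>. Digraph_Component.connected (with_proj G \<restriction> B))}"

definition singletons_partition :: "'a set \<Rightarrow> 'a set set" where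
  "singletons_partition A = (\<lambda>v. {v}) ` A"

text \<open>\<open>Gamma n\<close> is the graph \<open>\<Gamma>\<^sub>2\<^sub>n\<close> on \<open>2n\<close> vertices.\<close>

definition Gamma_edges :: "nat \<Rightarrow> (nat \<times> nat) set" where
  "Gamma_edges n = {(2 * i - 1, 2 * j) | i j. 1 \<le> i \<and> i \<le> j \<and> j \<le> n}"

definition Gamma :: "nat \<Rightarrow> nat pair_pre_digraph" where
  "Gamma n = \<lparr> pverts = {1..2 * n}, parcs = Gamma_edges n \<union> (Gamma_edges n)\<inverse> \<rparr>"

lemma pair_graph_Gamma: "pair_graph (Gamma n)"
proof
  show "finite (parcs (Gamma n))"
    by (rule finite_subset[of _ "{1..2 * n} \<times> {1..2 * n}"])
      (auto simp: Gamma_def Gamma_edges_def)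
  fix e assume "e \<in> parcs (Gamma n)"
  then have "odd (fst e) \<noteq> odd (snd e)"
    by (auto simp: Gamma_def Gamma_edges_def)
  then show "fst e \<noteq> snd e"
    by auto
qed (auto simp: Gamma_def Gamma_edges_def symmetric_def sym_def)

lemma finite_poset_bond_lattice:
  assumes "finite (pverts G)"
  shows "finite_poset (bond_lattice G) (refines (pverts G))"
proof -
  have "bond_lattice G \<subseteq> Pow (Pow (pverts G))"
    by (auto simp: bond_lattice_def partition_on_def)
  then have "finite (bond_lattice G)"
    by (rule finite_subset) (simp add: assms)
  moreover have "partial_order_on (bond_lattice G)
      (relation_of (refines (pverts G)) (bond_lattice G))"
    by (rule partial_order_on_relation_ofI)
      (auto simp: bond_lattice_def intro: refines_refl refines_trans dest: refines_asym)
  ultimately show ?thesis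
    by (simp add: finite_poset_def)
qed

section \<open>D-permutations\<close>

definition D_permutations :: "nat \<Rightarrow> (nat \<Rightarrow> nat) set" where
  "D_permutations m =
     {\<sigma>. \<sigma> permutes {1..m} \<and>
         (\<forall>i \<in> {1..m}. (odd i \<longrightarrow> i \<le> \<sigma> i) \<and> (even i \<longrightarrow> \<sigma> i \<le> i))}"

text \<open>Fixed points count as cycles.\<close>

definition cycle_support :: "'a set \<Rightarrow> ('a \<Rightarrow> 'a) \<Rightarrow> 'a set set" where
  "cycle_support A \<sigma> = orbit \<sigma> ` A"

definition s_D :: "nat \<Rightarrow> nat \<Rightarrow> int" where
  "s_D m k = (- 1) ^ k * int (card {\<sigma> \<in> D_permutations m. card (cycle_support {1..m} \<sigma>) = k})"

section \<open>The homogenized Linial arrangement\<close>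

text \<open>\<open>V\<close> is the ambient space, that is, the intersection of the empty subfamily of \<open>A\<close>.
  The order is reverse inclusion.\<close>

definition intersection_lattice :: "'a set \<Rightarrow> 'a set set \<Rightarrow> 'a set set" where
  "intersection_lattice V A = {V \<inter> \<Inter>B | B. B \<subseteq> A} - {{}}"

lemma finite_poset_intersection_lattice:
  assumes "finite A"
  shows "finite_poset (intersection_lattice V A) (\<supseteq>)"
proof -
  have "intersection_lattice V A \<subseteq> (\<lambda>B. V \<inter> \<Inter>B) ` Pow A"
    by (auto simp: intersection_lattice_def)
  then have "finite (intersection_lattice V A)"
    by (rule finite_subset) (simp add: assms)
  moreover have "partial_order_on (intersection_lattice V A)
      (relation_of (\<supseteq>) (intersection_lattice V A))"
    by (rule partial_order_on_relation_ofI) auto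
  ultimately show ?thesis
    by (simp add: finite_poset_def)
qed

text \<open>The coordinates of \<open>\<real>\<^sup>2\<^sup>n\<^sup>+\<^sup>2\<close> are \<open>x\<^sub>1, \<dots>, x\<^sub>n\<^sub>+\<^sub>1, y\<^sub>1, \<dots>, y\<^sub>n\<^sub>+\<^sub>1\<close> in
  this order; vectors are indexed from \<open>0\<close>. The last coordinate \<open>y\<^sub>n\<^sub>+\<^sub>1\<close> occurs in no equation.\<close>

definition x_coord :: "nat \<Rightarrow> real vec \<Rightarrow> nat \<Rightarrow> real" where
  "x_coord n v i = v $ (i - 1)"

definition y_coord :: "nat \<Rightarrow> real vec \<Rightarrow> nat \<Rightarrow> real" where
  "y_coord n v i = v $ (n + 1 + (i - 1))"

definition linial_arrangement :: "nat \<Rightarrow> real vec set set" where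
  "linial_arrangement n =
     {{v \<in> carrier_vec (2 * n + 2). x_coord n v i - x_coord n v j = y_coord n v i} | i j.
        1 \<le> i \<and> i < j \<and> j \<le> n + 1}"

end

theory Submission
  imports Defs
begin

text \<open>Summing the right-hand side over all partitions below \<open>\<pi>\<close> gives, up to sign, the sum of
  \<open>sgn \<sigma>\<close> over the D-permutations that preserve every block of \<open>\<pi>\<close>. A block with at least two
  elements induces a connected subgraph of \<open>\<Gamma>\<^sub>2\<^sub>n\<close> exactly if its least element \<open>a\<close> is odd and its
  greatest element \<open>b\<close> is even, and then \<open>\<sigma> \<mapsto> \<sigma> \<circ> (a b)\<close> is a sign-reversing involution. Hence the
  sum vanishes unless \<open>\<pi>\<close> is the bottom, which is the recursion that defines the Moebius function.

  A linear change of coordinates turns the arrangement into the graphic arrangement of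
  \<open>\<Gamma>\<^sub>2\<^sub>n\<close>, whose intersection lattice is the bond lattice.\<close>

section \<open>Finite posets\<close>

lemma finite_posetD:
  assumes "finite_poset P leq"
  shows "finite P"
    and "\<And>x. x \<in> P \<Longrightarrow> leq x x"
    and "\<And>x y z. x \<in> P \<Longrightarrow> y \<in> P \<Longrightarrow> z \<in> P \<Longrightarrow> leq x y \<Longrightarrow> leq y z \<Longrightarrow> leq x z"
    and "\<And>x y. x \<in> P \<Longrightarrow> y \<in> P \<Longrightarrow> leq x y \<Longrightarrow> leq y x \<Longrightarrow> x = y"
  using assms
  by (auto simp: finite_poset_def partial_order_on_def preorder_on_def relation_of_def
      refl_on_def antisym_def trans_def)

lemma sum_moebius:
  assumes "finite_poset P leq" "b \<in> P" "y \<in> P" "leq b y" "b \<noteq> y"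
  shows "(\<Sum>z \<in> {z \<in> P. leq b z \<and> leq z y}. moebius P leq b z) = 0"
proof -
  have "{z \<in> P. leq b z \<and> leq z y} = insert y {z \<in> P. leq b z \<and> leq z y \<and> z \<noteq> y}"
    using assms finite_posetD(2) by fastforce
  then have "(\<Sum>z \<in> {z \<in> P. leq b z \<and> leq z y}. moebius P leq b z) =
      moebius P leq b y + (\<Sum>z \<in> {z \<in> P. leq b z \<and> leq z y \<and> z \<noteq> y}. moebius P leq b z)"
    using finite_posetD(1)[OF assms(1)] by simp
  also have "\<dots> = 0"
    using assms by (subst moebius.simps) simp
  finally show ?thesis .
qed

text \<open>Vanishing interval sums from \<open>b\<close> are the Moebius recursion solved for its
  top term, so induction on the size of the ideal of \<open>y\<close> leaves only one solution.
  Moebius values can thus be verified for a guessed \<open>g\<close>.\<close>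

lemma moebius_eqI:
  assumes P: "finite_poset P leq" and b: "b \<in> P" "g b = 1"
    and sum0: "\<And>y. y \<in> P \<Longrightarrow> leq b y \<Longrightarrow> y \<noteq> b \<Longrightarrow>
      (\<Sum>z \<in> {z \<in> P. leq b z \<and> leq z y}. g z) = 0"
    and y: "y \<in> P" "leq b y"
  shows "moebius P leq b y = g y"
  using y
proof (induction "card {z \<in> P. leq z y}" arbitrary: y rule: less_induct)
  case less
  note D = finite_posetD[OF P]
  show ?case
  proof (cases "y = b")
    case True
    then show ?thesis
      using b D(2)[OF b(1)] P by (subst moebius.simps) simp
  next
    case False
    let ?I = "{z \<in> P. leq b z \<and> leq z y \<and> z \<noteq> y}"
    have IH: "moebius P leq b z = g z" if z: "z \<in> ?I" for z
    proof (rule less.hyps)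
      have "{w \<in> P. leq w z} \<subset> {w \<in> P. leq w y}"
        using z less.prems D(2,4) D(3)[of _ z y] by blast
      then show "card {w \<in> P. leq w z} < card {w \<in> P. leq w y}"
        using D(1) by (intro psubset_card_mono) auto
    qed (use z in auto)
    have "{z \<in> P. leq b z \<and> leq z y} = insert y ?I"
      using less.prems D(2) by blast
    with sum0[OF less.prems False] have "g y + (\<Sum>z \<in> ?I. g z) = 0"
      using D(1) by simp
    moreover have "moebius P leq b y = - (\<Sum>z \<in> ?I. moebius P leq b z)"
      using P b less.prems False by (subst moebius.simps) simp
    ultimately show ?thesis
      using IH by simp
  qed
qed

lemma poset_bot_eqI:
  assumes "finite_poset P leq" "b \<in> P" "\<And>x. x \<in> P \<Longrightarrow> leq b x"
  shows "poset_bot P leq = b"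
  unfolding poset_bot_def using assms finite_posetD(4)[OF assms(1)] by (intro the_equality) auto

text \<open>Strict monotonicity makes \<open>rk\<close> injective on a chain below \<open>x\<close>,
  so such a chain has at most \<open>rk x + 1\<close> elements. Descending by one in
  \<open>rk\<close> at each step builds a chain of exactly that size.\<close>

lemma poset_rank_eqI:
  fixes rk :: "'a \<Rightarrow> nat"
  assumes P: "finite_poset P leq"
    and strict: "\<And>x y. x \<in> P \<Longrightarrow> y \<in> P \<Longrightarrow> leq x y \<Longrightarrow> x \<noteq> y \<Longrightarrow> rk x < rk y"
    and lower: "\<And>x. x \<in> P \<Longrightarrow> 0 < rk x \<Longrightarrow> \<exists>y \<in> P. leq y x \<and> rk x = Suc (rk y)"
    and x: "x \<in> P"
  shows "poset_rank P leq x = rk x"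
proof -
  note D = finite_posetD[OF P]
  have chain: "\<exists>C \<in> Chains (relation_of leq {z \<in> P. leq z x}). card C = Suc (rk x)" if "x \<in> P" for x
    using that
  proof (induction "rk x" arbitrary: x)
    case 0
    then show ?case
      using D(2) by (intro bexI[of _ "{x}"]) (auto simp: Chains_def relation_of_def)
  next
    case (Suc k)
    then obtain y where y: "y \<in> P" "leq y x" "rk x = Suc (rk y)"
      using lower by force
    with Suc obtain C where C: "C \<in> Chains (relation_of leq {z \<in> P. leq z y})"
      and card: "card C = Suc (rk y)"
      by auto
    have sub: "C \<subseteq> {z \<in> P. leq z y}"
      using C by (auto simp: Chains_def relation_of_def)
    then have "x \<notin> C"
      using y strict[of x y] Suc.prems by force
    moreover have "finite C"
      using sub D(1) finite_subset by fastforce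
    moreover have "insert x C \<in> Chains (relation_of leq {z \<in> P. leq z x})"
      using C sub y D(2) D(3)[of _ y x] Suc.prems
      by (auto simp: Chains_def relation_of_def subset_iff)
    ultimately show ?case
      using card y by (intro bexI[of _ "insert x C"]) auto
  qed
  have bound: "card C - 1 \<le> rk x" if C: "C \<in> Chains (relation_of leq {z \<in> P. leq z x})" for C
  proof -
    have sub: "C \<subseteq> {z \<in> P. leq z x}"
      and tot: "\<And>a b. a \<in> C \<Longrightarrow> b \<in> C \<Longrightarrow> leq a b \<or> leq b a"
      using C by (auto simp: Chains_def relation_of_def)
    have "inj_on rk C"
      using sub tot strict by (intro inj_onI) (metis (no_types, lifting) less_irrefl mem_Collect_eq subsetD)
    moreover have "rk ` C \<subseteq> {..rk x}"
      using sub strict[of _ x] x by (force intro: less_imp_le)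
    ultimately have "card C \<le> card {..rk x}"
      by (intro card_inj_on_le) auto
    then show ?thesis
      by simp
  qed
  have "Chains (relation_of leq {z \<in> P. leq z x}) \<subseteq> Pow P"
    by (auto simp: Chains_def relation_of_def)
  then have "finite (Chains (relation_of leq {z \<in> P. leq z x}))"
    using D(1) finite_subset by blast
  then show ?thesis
    unfolding poset_rank_def poset_length_def
    using chain[OF x] bound by (intro Max_eqI) force+
qed

section \<open>Transport along order isomorphisms\<close>

lemma poset_length_iso:
  assumes f: "inj_on f P" and ord: "\<And>x y. x \<in> P \<Longrightarrow> y \<in> P \<Longrightarrow> leq' (f x) (f y) \<longleftrightarrow> leq x y"
  shows "poset_length (f ` P) leq' = poset_length P leq"
proof -
  have "Chains (relation_of leq' (f ` P)) = (`) f ` Chains (relation_of leq P)"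
  proof (intro subset_antisym subsetI)
    fix C assume C: "C \<in> Chains (relation_of leq' (f ` P))"
    let ?D = "{x \<in> P. f x \<in> C}"
    have "C \<subseteq> f ` P"
      using C by (auto simp: Chains_def relation_of_def)
    then have "C = f ` ?D"
      by auto
    moreover have "?D \<in> Chains (relation_of leq P)"
      using C ord by (auto simp: Chains_def relation_of_def)
    ultimately show "C \<in> (`) f ` Chains (relation_of leq P)"
      by blast
  next
    fix C assume "C \<in> (`) f ` Chains (relation_of leq P)"
    then obtain D where C: "C = f ` D" and D: "D \<in> Chains (relation_of leq P)"
      by auto
    then have "D \<subseteq> P" "\<And>a b. a \<in> D \<Longrightarrow> b \<in> D \<Longrightarrow> leq a b \<or> leq b a"
      by (auto simp: Chains_def relation_of_def)
    then show "C \<in> Chains (relation_of leq' (f ` P))"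
      using ord unfolding C Chains_def relation_of_def by (simp add: subset_iff)
  qed
  moreover have "card (f ` C) = card C" if "C \<in> Chains (relation_of leq P)" for C
    using that by (intro card_image inj_on_subset[OF f]) (auto simp: Chains_def relation_of_def)
  ultimately show ?thesis
    unfolding poset_length_def by (simp add: image_image)
qed

lemma characteristic_poly_iso:
  assumes P: "finite_poset P leq" and Q: "finite_poset (f ` P) leq'"
    and f: "inj_on f P" and ord: "\<And>x y. x \<in> P \<Longrightarrow> y \<in> P \<Longrightarrow> leq' (f x) (f y) \<longleftrightarrow> leq x y"
    and b: "b \<in> P" "\<And>x. x \<in> P \<Longrightarrow> leq b x"
  shows "characteristic_poly (f ` P) leq' = characteristic_poly P leq"
proof -
  have bot: "poset_bot P leq = b" "poset_bot (f ` P) leq' = f b"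
    using b ord by (auto intro!: poset_bot_eqI P Q)
  have ideal: "{z \<in> f ` P. leq' z (f x)} = f ` {z \<in> P. leq z x}" if "x \<in> P" for x
    using ord that by auto
  have rank: "poset_rank (f ` P) leq' (f x) = poset_rank P leq x" if "x \<in> P" for x
    unfolding poset_rank_def ideal[OF that]
    using inj_on_subset[OF f] ord by (intro poset_length_iso) auto
  \<comment> \<open>The Moebius function of the image, pulled back along \<open>f\<close>, plays the
    role of \<open>g\<close> in \<open>moebius_eqI\<close>; its interval sums vanish because
    \<open>f\<close> maps intervals onto intervals.\<close>
  have "moebius P leq b y = moebius (f ` P) leq' (f b) (f y)" if "y \<in> P" for y
  proof (rule moebius_eqI[OF P b(1)])
    show "moebius (f ` P) leq' (f b) (f b) = 1"
      using Q b ord by (subst moebius.simps) auto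
    fix y assume y: "y \<in> P" "leq b y" "y \<noteq> b"
    have "{z \<in> f ` P. leq' (f b) z \<and> leq' z (f y)} = f ` {z \<in> P. leq b z \<and> leq z y}"
      using ord y b by auto
    moreover have "inj_on f {z \<in> P. leq b z \<and> leq z y}"
      by (rule inj_on_subset[OF f]) auto
    moreover have "f b \<noteq> f y"
      using inj_onD[OF f] y b by metis
    ultimately show "(\<Sum>z \<in> {z \<in> P. leq b z \<and> leq z y}. moebius (f ` P) leq' (f b) (f z)) = 0"
      using sum_moebius[OF Q, of "f b" "f y"] y b ord by (simp add: sum.reindex)
  qed (use that b in auto)
  moreover have "poset_length (f ` P) leq' = poset_length P leq"
    using f ord by (rule poset_length_iso)
  ultimately show ?thesis
    unfolding characteristic_poly_def bot using rank
    by (simp add: sum.reindex[OF f] cong: sum.cong)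
qed

section \<open>Cycle supports and signs\<close>

lemma partition_on_block_unique:
  assumes "partition_on A \<pi>" "B \<in> \<pi>" "C \<in> \<pi>" "x \<in> B" "x \<in> C"
  shows "B = C"
  using assms by (auto simp: partition_on_def disjoint_def)

text \<open>\<open>orbit p x\<close> is generated from \<open>p x\<close>, so \<open>x\<close>
  itself belongs to it only because \<open>p\<close> permutes a finite set. The instance
  \<open>y = x\<close> provides that membership in later proofs.\<close>

lemma permutes_in_orbit_iff:
  assumes "finite S" "p permutes S"
  shows "y \<in> orbit p x \<longleftrightarrow> orbit p y = orbit p x"
  using assms
  by (metis cyclic_on_orbit orbit_cyclic_eq3 permutation_permutes permutation_self_in_orbit)

lemma partition_on_cycle_support:
  assumes "finite S" "p permutes S"
  shows "partition_on S (cycle_support S p)"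
proof (rule partition_onI)
  show "\<Union> (cycle_support S p) = S"
    using permutes_orbit_subset[OF assms(2)] permutes_in_orbit_iff[OF assms]
    unfolding cycle_support_def by blast
  show "disjnt B C" if "B \<in> cycle_support S p" "C \<in> cycle_support S p" "B \<noteq> C" for B C
    using that permutes_in_orbit_iff[OF assms] by (auto simp: cycle_support_def disjnt_def)
  show "{} \<notin> cycle_support S p"
    using orbit_nonempty by (metis cycle_support_def imageE)
qed

text \<open>A set closed under \<open>p\<close> contains the orbits of its elements. The right-hand
  side is a condition on single values of \<open>p\<close>, which is easy to check after composing
  with a transposition.\<close>

lemma refines_cycle_support_iff:
  assumes "finite S" "p permutes S" "partition_on S \<pi>"
  shows "refines S (cycle_support S p) \<pi> \<longleftrightarrow> (\<forall>B \<in> \<pi>. \<forall>x \<in> B. p x \<in> B)"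
proof
  assume ref: "refines S (cycle_support S p) \<pi>"
  show "\<forall>B \<in> \<pi>. \<forall>x \<in> B. p x \<in> B"
  proof (intro ballI)
    fix B x assume B: "B \<in> \<pi>" "x \<in> B"
    then have "x \<in> S"
      using assms(3) by (auto simp: partition_on_def)
    then obtain C where C: "C \<in> \<pi>" "orbit p x \<subseteq> C"
      using ref by (auto simp: refines_def cycle_support_def)
    moreover have "x \<in> orbit p x"
      using permutes_in_orbit_iff[OF assms(1,2)] by simp
    ultimately have "C = B"
      using B partition_on_block_unique[OF assms(3)] by blast
    then show "p x \<in> B"
      using C orbit.base[of p x] by auto
  qed
next
  assume inv: "\<forall>B \<in> \<pi>. \<forall>x \<in> B. p x \<in> B"
  have "\<exists>B \<in> \<pi>. orbit p x \<subseteq> B" if "x \<in> S" for x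
  proof -
    obtain B where B: "B \<in> \<pi>" "x \<in> B"
      using \<open>x \<in> S\<close> assms(3) by (auto simp: partition_on_def)
    have "y \<in> B" if "y \<in> orbit p x" for y
      using that B inv by induction auto
    with B show ?thesis
      by auto
  qed
  then show "refines S (cycle_support S p) \<pi>"
    using assms partition_on_cycle_support by (auto simp: refines_def cycle_support_def)
qed

text \<open>\<open>q\<close> sends the preimage of \<open>a\<close> directly to \<open>p a\<close>
  and fixes \<open>a\<close>: the point \<open>a\<close> is cut out of its cycle, and all other
  cycles stay as they are.\<close>

lemma orbit_remove_point:
  fixes p :: "'a \<Rightarrow> 'a"
  assumes S: "finite S" "p permutes insert a S" "a \<notin> S" and ne: "p a \<noteq> a" and x: "x \<in> S"
  defines "q \<equiv> transpose a (p a) \<circ> p"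
  shows "orbit q x = orbit p x - {a}"
proof -
  have inj: "p y = p z \<longleftrightarrow> y = z" for y z
    using permutes_inj[OF S(2)] by (auto simp: inj_def)
  have q: "q y = (if p y = a then p a else p y)" if "y \<noteq> a" for y
    using that inj[of y a] by (auto simp: q_def transpose_def)
  have "q permutes S"
    unfolding q_def using S(2) by (rule permutes_insert_lemma)
  then have sub: "orbit q x \<subseteq> S"
    using x by (rule permutes_orbit_subset)
  have xa: "x \<noteq> a"
    using x S by auto
  have "y \<in> orbit p x" if "y \<in> orbit q x" for y
    using that
  proof induction
    case base
    then show ?case
      using q[OF xa] orbit.base[of p x] orbit.step[of "p x" p x] by auto
  next
    case (step y)
    then have "y \<noteq> a"
      using sub S(3) by auto
    then show ?case
      using q[of y] orbit.step[OF step.IH] orbit.step[OF orbit.step[OF step.IH]] by auto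
  qed
  \<comment> \<open>The \<open>p\<close>-orbit may pass through \<open>a\<close>, which the
    \<open>q\<close>-orbit skips. Replacing \<open>a\<close> by its successor \<open>p a\<close>
    gives a claim that survives the induction.\<close>
  moreover have "(if y = a then p a else y) \<in> orbit q x" if "y \<in> orbit p x" for y
    using that
  proof induction
    case base
    then show ?case
      using q[OF xa] orbit.base[of q x] by auto
  next
    case (step y)
    show ?case
    proof (cases "y = a")
      case True
      then show ?thesis
        using step.IH ne by simp
    next
      case False
      then show ?thesis
        using q[OF False] step.IH orbit.step[of y q x] by auto
    qed
  qed
  ultimately show ?thesis
    using sub S(3) by (fastforce split: if_splits)
qed

text \<open>Induction on the ground set. Dropping a fixed point loses one element and one cycle, so
  the parity of the exponent stays; cutting out a moved point loses one element, no cycle, and one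
  transposition. The exponent is a sum instead of the usual difference, with the same
  parity.\<close>

lemma sign_cycle_support:
  assumes "finite S" "p permutes S"
  shows "sign p = (- 1) ^ (card S + card (cycle_support S p))"
  using assms
proof (induction S arbitrary: p rule: finite_induct)
  case empty
  then show ?case
    by (simp add: cycle_support_def)
next
  case (insert a S)
  have fin: "finite (insert a S)"
    using insert.hyps by simp
  define q where "q = transpose a (p a) \<circ> p"
  have q: "q permutes S"
    unfolding q_def using insert.prems by (rule permutes_insert_lemma)
  have IH: "sign q = (- 1) ^ (card S + card (cycle_support S q))"
    using insert.IH[OF q] .
  show ?case
  proof (cases "p a = a")
    case True
    then have "q = p"
      by (simp add: q_def)
    have "orbit p a = {a}"
      using True by (simp add: orbit_eq_singleton_iff)
    moreover have "{a} \<notin> cycle_support S p"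
      using partition_on_cycle_support[OF insert.hyps(1) q] insert.hyps(2) \<open>q = p\<close>
      by (auto simp: partition_on_def)
    ultimately show ?thesis
      using IH \<open>q = p\<close> insert.hyps by (simp add: cycle_support_def)
  next
    case False
    have orb: "orbit q x = orbit p x - {a}" if "x \<in> S" for x
      unfolding q_def using insert.hyps insert.prems False that by (intro orbit_remove_point) auto
    have "p a \<in> S"
      using False permutes_in_image[OF insert.prems, of a] by auto
    moreover have "orbit p a = orbit p (p a)"
      using permutes_in_orbit_iff[OF fin insert.prems, of "p a" a] orbit.base[of p a] by simp
    ultimately have cs: "cycle_support (insert a S) p = orbit p ` S"
      by (auto simp: cycle_support_def)
    have "cycle_support S q = (\<lambda>C. C - {a}) ` orbit p ` S"
      unfolding cycle_support_def image_image by (rule image_cong[OF refl orb])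
    moreover have "inj_on (\<lambda>C. C - {a}) (orbit p ` S)"
    proof (intro inj_onI, elim imageE)
      fix C D x y
      assume eq: "C - {a} = D - {a}" and C: "C = orbit p x" "x \<in> S" and D: "D = orbit p y"
      \<comment> \<open>Deleting \<open>a\<close> merges no two cycles: each contains a point of
        \<open>S\<close>, which differs from \<open>a\<close> and so still identifies it.\<close>
      have "x \<in> orbit p x"
        using permutes_in_orbit_iff[OF fin insert.prems] by simp
      then have "x \<in> orbit p y"
        using eq C D insert.hyps(2) by auto
      then show "C = D"
        using C D permutes_in_orbit_iff[OF fin insert.prems] by simp
    qed
    ultimately have "card (cycle_support S q) = card (cycle_support (insert a S) p)"
      using cs by (simp add: card_image)
    moreover have "sign q = - sign p"
      unfolding q_def using False permutation_permutes[of p] fin insert.prems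
      by (subst sign_compose) (auto simp: sign_swap_id permutation_swap_id)
    ultimately show ?thesis
      using IH insert.hyps by simp
  qed
qed

section \<open>The bond lattice of \<open>\<Gamma>\<^sub>2\<^sub>n\<close>\<close>

text \<open>For \<open>x = 2 * i - 1\<close> and \<open>y = 2 * j\<close>, the condition
  \<open>i \<le> j\<close> says \<open>x < y\<close>. Adjacency thus depends on parity and order
  only.\<close>

lemma Gamma_edges_iff:
  "(x, y) \<in> Gamma_edges n \<longleftrightarrow> 1 \<le> x \<and> y \<le> 2 * n \<and> odd x \<and> even y \<and> x < y"
proof
  assume xy: "1 \<le> x \<and> y \<le> 2 * n \<and> odd x \<and> even y \<and> x < y"
  then obtain i j where "x = 2 * i + 1" "y = 2 * j"
    by (elim conjE oddE evenE)
  then show "(x, y) \<in> Gamma_edges n"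
    using xy unfolding Gamma_edges_def
    by (intro CollectI exI[of _ "Suc i"] exI[of _ j]) auto
qed (auto simp: Gamma_edges_def)

lemma Gamma_arcs_iff:
  "(x, y) \<in> parcs (Gamma n) \<longleftrightarrow>
    x \<in> {1..2 * n} \<and> y \<in> {1..2 * n} \<and> (odd x \<and> even y \<and> x < y \<or> even x \<and> odd y \<and> y < x)"
  by (auto simp: Gamma_def Gamma_edges_iff)

text \<open>The different parities give \<open>a < b\<close>, so a set with such bounds is never a
  singleton.\<close>

definition odd_even_bounds :: "nat set \<Rightarrow> nat \<Rightarrow> nat \<Rightarrow> bool" where
  "odd_even_bounds B a b \<longleftrightarrow>
     a \<in> B \<and> b \<in> B \<and> odd a \<and> even b \<and> (\<forall>x \<in> B. a \<le> x \<and> x \<le> b)"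

text \<open>An even minimum or an odd maximum would contradict the last two hypotheses. The
  criterion serves connected vertex sets, cycles of D-permutations and components of edge sets
  alike.\<close>

lemma odd_even_boundsI:
  assumes "finite B" "B \<noteq> {}" "\<nexists>x. B = {x}"
    and odd: "\<And>x. x \<in> B \<Longrightarrow> even x \<Longrightarrow> \<exists>y \<in> B. y < x"
    and even: "\<And>x. x \<in> B \<Longrightarrow> odd x \<Longrightarrow> \<exists>y \<in> B. x < y"
  shows "\<exists>a b. odd_even_bounds B a b"
proof -
  have "odd (Min B)" "even (Max B)"
    using odd[of "Min B"] even[of "Max B"] assms(1,2) by (auto simp: not_less[symmetric])
  then show ?thesis
    using assms(1,2) unfolding odd_even_bounds_def
    by (intro exI[of _ "Min B"] exI[of _ "Max B"]) auto
qed

lemma rtrancl_on_imp_step: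
  assumes "(x, y) \<in> rtrancl_on F r" "x \<noteq> y"
  shows "\<exists>z \<in> F. (x, z) \<in> r"
  using assms by induction auto

text \<open>In a connected set with several vertices each vertex has a neighbour, which is smaller
  for an even vertex and larger for an odd one. Conversely, \<open>a\<close> is adjacent to every
  even vertex of \<open>B\<close> and \<open>b\<close> to every odd one, among them
  \<open>a\<close>, so all vertices are linked.\<close>

lemma connected_Gamma_iff:
  assumes B: "B \<subseteq> {1..2 * n}"
  shows "Digraph_Component.connected (with_proj (Gamma n) \<restriction> B) \<longleftrightarrow>
    (\<exists>x. B = {x}) \<or> (\<exists>a b. odd_even_bounds B a b)"
proof -
  define E where "E = {(x, y) \<in> parcs (Gamma n). x \<in> B \<and> y \<in> B}"
  have E_iff: "(x, y) \<in> E \<longleftrightarrow>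
    x \<in> B \<and> y \<in> B \<and> (odd x \<and> even y \<and> x < y \<or> even x \<and> odd y \<and> y < x)" for x y
    using B by (auto simp: E_def Gamma_arcs_iff)
  \<comment> \<open>Connectedness is strong connectedness of the symmetrized digraph; the arcs of
    \<open>Gamma n\<close> are symmetric already, so symmetrizing adds nothing.\<close>
  have "parcs (mk_symmetric (with_proj (Gamma n) \<restriction> B)) = E"
    unfolding parcs_mk_symmetric by (force simp: induce_subgraph_def E_def Gamma_arcs_iff)
  then have conn: "Digraph_Component.connected (with_proj (Gamma n) \<restriction> B) \<longleftrightarrow>
      B \<noteq> {} \<and> (\<forall>u \<in> B. \<forall>v \<in> B. (u, v) \<in> rtrancl_on B E)"
    by (simp add: Digraph_Component.connected_def strongly_connected_def reachable_def)
  show ?thesis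
    unfolding conn
  proof (intro iffI; (elim disjE exE)?)
    assume C: "B \<noteq> {} \<and> (\<forall>u \<in> B. \<forall>v \<in> B. (u, v) \<in> rtrancl_on B E)"
    have nbr: "\<exists>y \<in> B. (x, y) \<in> E" if "x \<in> B" "\<nexists>x. B = {x}" for x
    proof -
      have "B \<noteq> {x}"
        using that by blast
      then obtain z where "z \<in> B" "z \<noteq> x"
        using \<open>x \<in> B\<close> by blast
      then show ?thesis
        using C \<open>x \<in> B\<close> rtrancl_on_imp_step[of x z B E] by blast
    qed
    have "finite B"
      using B finite_subset by blast
    moreover have "\<exists>y \<in> B. y < x" if "x \<in> B" "even x" "\<nexists>x. B = {x}" for x
      using nbr[OF that(1,3)] that(2) unfolding E_iff by blast
    moreover have "\<exists>y \<in> B. x < y" if "x \<in> B" "odd x" "\<nexists>x. B = {x}" for x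
      using nbr[OF that(1,3)] that(2) unfolding E_iff by blast
    ultimately show "(\<exists>x. B = {x}) \<or> (\<exists>a b. odd_even_bounds B a b)"
      using C odd_even_boundsI[of B] by blast
  next
    fix x assume "B = {x}"
    then show "B \<noteq> {} \<and> (\<forall>u \<in> B. \<forall>v \<in> B. (u, v) \<in> rtrancl_on B E)"
      by auto
  next
    fix a b assume ab: "odd_even_bounds B a b"
    have step: "(x, y) \<in> rtrancl_on B E" if "(x, y) \<in> E" for x y
      using that E_iff by (auto intro: rtrancl_on_into_rtrancl_on[of x x])
    have "(x, a) \<in> rtrancl_on B E \<and> (a, x) \<in> rtrancl_on B E" if "x \<in> B" for x
    proof (cases "even x")
      case True
      then have "a \<noteq> x" "a \<le> x"
        using ab that by (auto simp: odd_even_bounds_def)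
      then have "(x, a) \<in> E" "(a, x) \<in> E"
        using ab that True unfolding E_iff by (auto simp: odd_even_bounds_def)
      then show ?thesis
        using step by blast
    next
      case False
      have "a \<noteq> b" "a \<le> b" "x \<noteq> b" "x \<le> b"
        using ab that False by (auto simp: odd_even_bounds_def)
      then have "(x, b) \<in> E" "(b, a) \<in> E" "(a, b) \<in> E" "(b, x) \<in> E"
        using ab that False unfolding E_iff by (auto simp: odd_even_bounds_def)
      then show ?thesis
        using rtrancl_on_trans[OF step step] by blast
    qed
    then have "(u, v) \<in> rtrancl_on B E" if "u \<in> B" "v \<in> B" for u v
      using rtrancl_on_trans that by metis
    moreover have "B \<noteq> {}"
      using ab by (auto simp: odd_even_bounds_def)
    ultimately show "B \<noteq> {} \<and> (\<forall>u \<in> B. \<forall>v \<in> B. (u, v) \<in> rtrancl_on B E)"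
      by blast
  qed
qed

lemma bond_lattice_Gamma_iff:
  "\<pi> \<in> bond_lattice (Gamma n) \<longleftrightarrow> partition_on {1..2 * n} \<pi> \<and>
    (\<forall>B \<in> \<pi>. (\<exists>x. B = {x}) \<or> (\<exists>a b. odd_even_bounds B a b))"
proof -
  have "pverts (Gamma n) = {1..2 * n}"
    by (simp add: Gamma_def)
  moreover have "B \<subseteq> {1..2 * n}" if "partition_on {1..2 * n} \<pi>" "B \<in> \<pi>" for B
    using that by (auto simp: partition_on_def)
  ultimately show ?thesis
    unfolding bond_lattice_def using connected_Gamma_iff by auto
qed

lemma finite_poset_bond_lattice_Gamma:
  "finite_poset (bond_lattice (Gamma n)) (refines {1..2 * n})"
  using finite_poset_bond_lattice[of "Gamma n"] by (simp add: Gamma_def)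

lemma partition_on_singletons_partition: "partition_on A (singletons_partition A)"
  unfolding singletons_partition_def by (rule partition_on_singletons)

lemma singletons_partition_in_bond_lattice:
  "singletons_partition {1..2 * n} \<in> bond_lattice (Gamma n)"
  unfolding bond_lattice_Gamma_iff
  using partition_on_singletons_partition by (auto simp: singletons_partition_def)

lemma refines_singletons_partition:
  "refines A (singletons_partition A) \<pi> \<longleftrightarrow> partition_on A \<pi>"
  using partition_on_singletons_partition[of A]
  by (auto simp: refines_def singletons_partition_def partition_on_def)

lemma eq_singletons_partitionI:
  assumes "partition_on A \<pi>" "\<And>B. B \<in> \<pi> \<Longrightarrow> \<exists>x. B = {x}"
  shows "\<pi> = singletons_partition A"
proof -
  have "refines A \<pi> (singletons_partition A)"
    using assms partition_on_singletons_partition[of A]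
    by (fastforce simp: refines_def singletons_partition_def partition_on_def)
  then show ?thesis
    using assms(1) refines_singletons_partition refines_asym by blast
qed

section \<open>D-permutations and the bond lattice\<close>

lemma cycle_support_D_permutation:
  assumes "\<sigma> \<in> D_permutations (2 * n)"
  shows "cycle_support {1..2 * n} \<sigma> \<in> bond_lattice (Gamma n)"
proof -
  have perm: "\<sigma> permutes {1..2 * n}"
    and D: "\<And>i. i \<in> {1..2 * n} \<Longrightarrow> odd i \<Longrightarrow> i \<le> \<sigma> i" "\<And>i. i \<in> {1..2 * n} \<Longrightarrow> even i \<Longrightarrow> \<sigma> i \<le> i"
    using assms by (auto simp: D_permutations_def)
  have part: "partition_on {1..2 * n} (cycle_support {1..2 * n} \<sigma>)"
    using perm by (intro partition_on_cycle_support) auto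
  have "\<exists>a b. odd_even_bounds B a b"
    if B: "B \<in> cycle_support {1..2 * n} \<sigma>" "\<nexists>x. B = {x}" for B
  proof (rule odd_even_boundsI)
    have sub: "B \<subseteq> {1..2 * n}" and "B \<noteq> {}"
      using part B by (auto simp: partition_on_def)
    then show "finite B" "B \<noteq> {}"
      using finite_subset by auto
    \<comment> \<open>On a cycle with several elements every point is moved, so the weak
      inequalities of a D-permutation become strict: even points have a smaller image in the cycle,
      odd points a larger one.\<close>
    have move: "\<sigma> x \<in> B \<and> \<sigma> x \<noteq> x" if x: "x \<in> B" for x
    proof -
      obtain y where "B = orbit \<sigma> y"
        using B by (auto simp: cycle_support_def)
      then have "B = orbit \<sigma> x"
        using x permutes_in_orbit_iff[OF _ perm] by simp
      then show ?thesis
        using B(2) orbit.base[of \<sigma> x] orbit_eq_singleton_iff by metis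
    qed
    show "\<exists>y \<in> B. y < x" if "x \<in> B" "even x" for x
      using that move[of x] D(2)[of x] sub by (intro bexI[of _ "\<sigma> x"]) auto
    show "\<exists>y \<in> B. x < y" if "x \<in> B" "odd x" for x
      using that move[of x] D(1)[of x] sub by (intro bexI[of _ "\<sigma> x"]) auto
  qed (use B in auto)
  with part show ?thesis
    unfolding bond_lattice_Gamma_iff by blast
qed

lemma finite_D_permutations: "finite (D_permutations m)"
  by (rule finite_subset[OF _ finite_permutations[of "{1..m}"]]) (auto simp: D_permutations_def)

text \<open>Composition with the transposition of the least and the greatest element of a
  non-singleton block is a sign-reversing involution; equivalently, the sum is a determinant
  with two equal rows.\<close>

lemma sum_D_permutations_refines:
  assumes \<pi>: "\<pi> \<in> bond_lattice (Gamma n)" and ne: "\<pi> \<noteq> singletons_partition {1..2 * n}"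
  shows "(\<Sum>\<sigma> | \<sigma> \<in> D_permutations (2 * n) \<and> refines {1..2 * n} (cycle_support {1..2 * n} \<sigma>) \<pi>.
      (- 1) ^ card (cycle_support {1..2 * n} \<sigma>)) = (0 :: int)" (is "sum ?f ?S = 0")
proof -
  let ?A = "{1..2 * n}"
  have part: "partition_on ?A \<pi>"
    using \<pi> by (simp add: bond_lattice_Gamma_iff)
  then obtain B where "B \<in> \<pi>" "\<nexists>x. B = {x}"
    using ne eq_singletons_partitionI by blast
  then obtain a b where B: "B \<in> \<pi>" "odd_even_bounds B a b"
    using \<pi> unfolding bond_lattice_Gamma_iff by blast
  then have ab: "a \<in> B" "b \<in> B" "odd a" "even b" "\<And>x. x \<in> B \<Longrightarrow> a \<le> x" "\<And>x. x \<in> B \<Longrightarrow> x \<le> b"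
    by (auto simp: odd_even_bounds_def)
  have "B \<subseteq> ?A"
    using B part by (auto simp: partition_on_def)
  then have abA: "a \<in> ?A" "b \<in> ?A"
    using ab by auto
  have S_iff: "\<sigma> \<in> ?S \<longleftrightarrow> \<sigma> permutes ?A \<and>
      (\<forall>i \<in> ?A. (odd i \<longrightarrow> i \<le> \<sigma> i) \<and> (even i \<longrightarrow> \<sigma> i \<le> i)) \<and>
      (\<forall>C \<in> \<pi>. \<forall>x \<in> C. \<sigma> x \<in> C)" for \<sigma>
    using refines_cycle_support_iff[OF _ _ part] by (auto simp: D_permutations_def)
  define h where "h \<sigma> = \<sigma> \<circ> transpose a b" for \<sigma> :: "nat \<Rightarrow> nat"
  have h_simps: "h \<sigma> x = (if x = a then \<sigma> b else if x = b then \<sigma> a else \<sigma> x)" for \<sigma> x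
    by (auto simp: h_def transpose_def)
  have h_h: "h (h \<sigma>) = \<sigma>" for \<sigma>
    by (simp add: h_def o_assoc[symmetric])
  have h_perm: "h \<sigma> permutes ?A" if "\<sigma> permutes ?A" for \<sigma>
    unfolding h_def by (rule permutes_compose[OF permutes_swap_id[OF abA] that])
  \<comment> \<open>Only the values at \<open>a\<close> and \<open>b\<close> are exchanged, and both
    lie in \<open>B\<close>. They satisfy the inequalities at their new places because
    \<open>a\<close> is odd and the minimum of \<open>B\<close>, and \<open>b\<close> is even and
    the maximum.\<close>
  have h_S: "h \<sigma> \<in> ?S" if \<sigma>: "\<sigma> \<in> ?S" for \<sigma>
  proof -
    note \<sigma> = \<sigma>[unfolded S_iff]
    have "\<sigma> a \<in> B" "\<sigma> b \<in> B"
      using \<sigma> B ab by auto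
    moreover have "C = B" if "C \<in> \<pi>" "a \<in> C \<or> b \<in> C" for C
      using partition_on_block_unique[OF part] that B ab by blast
    ultimately show ?thesis
      unfolding S_iff using \<sigma> ab h_perm[of \<sigma>] by (auto simp: h_simps)
  qed
  \<comment> \<open>The ground set has the even number \<open>2 * n\<close> of elements, so its
    contribution to the exponent in \<open>sign_cycle_support\<close> disappears.\<close>
  have "?f \<sigma> = sign \<sigma>" if "\<sigma> permutes ?A" for \<sigma>
    using sign_cycle_support[OF _ that] by (simp add: power_add)
  then have f_h: "?f (h \<sigma>) = - ?f \<sigma>" if "\<sigma> \<in> ?S" for \<sigma>
  proof -
    have "\<sigma> permutes ?A" "a \<noteq> b"
      using that ab S_iff by auto
    then have "sign (h \<sigma>) = - sign \<sigma>"
      unfolding h_def using permutation_permutes[of \<sigma>]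
      by (subst sign_compose) (auto simp: sign_swap_id permutation_swap_id)
    then show ?thesis
      using \<open>\<And>\<sigma>. \<sigma> permutes ?A \<Longrightarrow> ?f \<sigma> = sign \<sigma>\<close> \<open>\<sigma> permutes ?A\<close> h_perm by simp
  qed
  have "sum ?f ?S = (\<Sum>\<sigma> \<in> ?S. - ?f \<sigma>)"
    using h_S h_h f_h by (intro sum.reindex_bij_witness[of _ h h]) auto
  then show ?thesis
    by (simp add: sum_negf)
qed

section \<open>The homogenized Linial arrangement\<close>

text \<open>The hyperplane \<open>x\<^sub>i - x\<^sub>j = y\<^sub>i\<close> is \<open>u\<^sub>2\<^sub>i\<^sub>-\<^sub>1 = u\<^sub>2\<^sub>(\<^sub>j\<^sub>-\<^sub>1\<^sub>)\<close> in the coordinates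
  \<open>u\<^sub>2\<^sub>i\<^sub>-\<^sub>1 = x\<^sub>i - y\<^sub>i\<close> and \<open>u\<^sub>2\<^sub>i = x\<^sub>i\<^sub>+\<^sub>1\<close>, so the arrangement is the pullback of the
  graphic arrangement of \<open>\<Gamma>\<^sub>2\<^sub>n\<close>.\<close>

definition u_coord :: "nat \<Rightarrow> real vec \<Rightarrow> nat \<Rightarrow> real" where
  "u_coord n v p =
     (if odd p then x_coord n v (Suc (p div 2)) - y_coord n v (Suc (p div 2))
      else x_coord n v (Suc (p div 2)))"

definition u_hyperplane :: "nat \<Rightarrow> nat \<times> nat \<Rightarrow> real vec set" where
  "u_hyperplane n e = {v \<in> carrier_vec (2 * n + 2). u_coord n v (fst e) = u_coord n v (snd e)}"

definition block_flat :: "nat \<Rightarrow> nat set set \<Rightarrow> real vec set" where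
  "block_flat n \<pi> =
     {v \<in> carrier_vec (2 * n + 2). \<forall>B \<in> \<pi>. \<forall>p \<in> B. \<forall>q \<in> B. u_coord n v p = u_coord n v q}"

lemma linial_arrangement_eq: "linial_arrangement n = u_hyperplane n ` Gamma_edges n"
proof -
  have *: "u_hyperplane n (2 * i - 1, 2 * j) =
      {v \<in> carrier_vec (2 * n + 2). x_coord n v i - x_coord n v (Suc j) = y_coord n v i}"
    if "1 \<le> i" for i j
  proof -
    obtain k where "i = Suc k"
      using \<open>1 \<le> i\<close> by (cases i) auto
    then show ?thesis
      by (auto simp: u_hyperplane_def u_coord_def)
  qed
  have "linial_arrangement n = {u_hyperplane n (2 * i - 1, 2 * j) | i j. 1 \<le> i \<and> i \<le> j \<and> j \<le> n}"
  proof (intro subset_antisym subsetI)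
    fix H assume "H \<in> linial_arrangement n"
    then obtain i j where ij: "1 \<le> i" "i < j" "j \<le> n + 1"
      and H: "H = {v \<in> carrier_vec (2 * n + 2). x_coord n v i - x_coord n v j = y_coord n v i}"
      unfolding linial_arrangement_def by blast
    then have "H = u_hyperplane n (2 * i - 1, 2 * (j - 1))"
      using *[of i "j - 1"] by simp
    moreover have "i \<le> j - 1" "j - 1 \<le> n"
      using ij by auto
    ultimately show "H \<in> {u_hyperplane n (2 * i - 1, 2 * j) | i j. 1 \<le> i \<and> i \<le> j \<and> j \<le> n}"
      using ij by blast
  next
    fix H assume "H \<in> {u_hyperplane n (2 * i - 1, 2 * j) | i j. 1 \<le> i \<and> i \<le> j \<and> j \<le> n}"
    then obtain i j where "1 \<le> i" "i \<le> j" "j \<le> n" "H = u_hyperplane n (2 * i - 1, 2 * j)"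
      by blast
    then show "H \<in> linial_arrangement n"
      unfolding linial_arrangement_def using * by (intro CollectI exI[of _ i] exI[of _ "Suc j"]) auto
  qed
  also have "\<dots> = u_hyperplane n ` Gamma_edges n"
    unfolding Gamma_edges_def by blast
  finally show ?thesis .
qed

section \<open>Flats of the arrangement and partitions\<close>

lemma u_coord_surj:
  fixes w :: "nat \<Rightarrow> real"
  shows "\<exists>v \<in> carrier_vec (2 * n + 2). \<forall>p \<in> {1..2 * n}. u_coord n v p = w p"
proof -
  \<comment> \<open>\<open>X k\<close> is the value of \<open>x_coord\<close> at
    \<open>Suc k\<close>. The coordinate at index 1 is free and set to 0, the others are prescribed
    by even \<open>p\<close>; then each odd \<open>p\<close> determines one
    \<open>y_coord\<close>.\<close>
  define X where "X k = (if k = 0 then 0 else w (2 * k))" for k :: nat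
  define v where "v = vec (2 * n + 2)
    (\<lambda>k. if k \<le> n then X k else X (k - Suc n) - w (Suc (2 * (k - Suc n))))"
  have "u_coord n v p = w p" if p: "p \<in> {1..2 * n}" for p
  proof (cases "even p")
    case True
    then obtain k where "p = 2 * k"
      by (elim evenE)
    then show ?thesis
      using p by (simp add: u_coord_def x_coord_def v_def X_def)
  next
    case False
    then obtain k where "p = 2 * k + 1"
      by (elim oddE)
    then show ?thesis
      using p by (simp add: u_coord_def x_coord_def y_coord_def v_def)
  qed
  moreover have "v \<in> carrier_vec (2 * n + 2)"
    by (simp add: v_def)
  ultimately show ?thesis
    by blast
qed

text \<open>If a block of \<pi> met a block \<open>C\<close> of \<tau> without lying in it, a vector
  whose \<open>u_coord\<close> values are the indicator of \<open>C\<close> would lie in the flat of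
  \<tau> but not in that of \<pi>. The equivalence also makes \<open>block_flat\<close> injective on
  partitions.\<close>

lemma block_flat_subset_iff:
  assumes \<pi>: "partition_on {1..2 * n} \<pi>" and \<tau>: "partition_on {1..2 * n} \<tau>"
  shows "block_flat n \<tau> \<subseteq> block_flat n \<pi> \<longleftrightarrow> refines {1..2 * n} \<pi> \<tau>"
proof
  assume "refines {1..2 * n} \<pi> \<tau>"
  then show "block_flat n \<tau> \<subseteq> block_flat n \<pi>"
    unfolding refines_def block_flat_def by blast
next
  assume sub: "block_flat n \<tau> \<subseteq> block_flat n \<pi>"
  have "\<exists>C \<in> \<tau>. B \<subseteq> C" if B: "B \<in> \<pi>" for B
  proof -
    obtain p where p: "p \<in> B"
      using B \<pi> by (fastforce simp: partition_on_def)
    have BA: "B \<subseteq> {1..2 * n}"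
      using B \<pi> by (auto simp: partition_on_def)
    then obtain C where C: "C \<in> \<tau>" "p \<in> C"
      using p \<tau> by (auto simp: partition_on_def)
    obtain v where v: "v \<in> carrier_vec (2 * n + 2)"
      and u: "\<And>q. q \<in> {1..2 * n} \<Longrightarrow> u_coord n v q = (if q \<in> C then 1 else 0)"
      using u_coord_surj[of n "\<lambda>q. if q \<in> C then 1 else 0"] by blast
    have "u_coord n v q = u_coord n v r" if D: "D \<in> \<tau>" "q \<in> D" "r \<in> D" for D q r
    proof -
      have "q \<in> C \<longleftrightarrow> r \<in> C"
        using partition_on_block_unique[OF \<tau>] D C(1) by metis
      moreover have "q \<in> {1..2 * n}" "r \<in> {1..2 * n}"
        using D \<tau> by (auto simp: partition_on_def)
      ultimately show ?thesis
        using u by simp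
    qed
    then have "v \<in> block_flat n \<tau>"
      using v unfolding block_flat_def by blast
    then have "v \<in> block_flat n \<pi>"
      using sub by blast
    then have const: "u_coord n v q = u_coord n v p" if "q \<in> B" for q
      using B p that unfolding block_flat_def by blast
    have "q \<in> C" if "q \<in> B" for q
    proof -
      have "u_coord n v q = 1"
        using const[OF that] u[of p] BA C(2) p by auto
      then show ?thesis
        using u[of q] BA that by (metis subsetD zero_neq_one)
    qed
    with C show ?thesis
      by blast
  qed
  with \<pi> \<tau> show "refines {1..2 * n} \<pi> \<tau>"
    by (auto simp: refines_def)
qed

text \<open>The edges inside a block suffice: equality of coordinates spreads from \<open>a\<close>
  to all even elements, among them \<open>b\<close>, and from \<open>b\<close> to all odd elements.
  Hence every such flat is an intersection of hyperplanes.\<close>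

lemma block_flat_eq_Inter:
  assumes "\<pi> \<in> bond_lattice (Gamma n)"
  shows "block_flat n \<pi> = carrier_vec (2 * n + 2) \<inter>
    \<Inter> (u_hyperplane n ` {(x, y) \<in> Gamma_edges n. \<exists>B \<in> \<pi>. x \<in> B \<and> y \<in> B})" (is "_ = ?R")
proof (intro subset_antisym subsetI)
  fix v assume "v \<in> block_flat n \<pi>"
  then have v: "v \<in> carrier_vec (2 * n + 2)"
    and eq: "\<And>B p q. B \<in> \<pi> \<Longrightarrow> p \<in> B \<Longrightarrow> q \<in> B \<Longrightarrow> u_coord n v p = u_coord n v q"
    unfolding block_flat_def by blast+
  have "v \<in> u_hyperplane n (x, y)" if "B \<in> \<pi>" "x \<in> B" "y \<in> B" for x y B
    using v eq[OF that] by (simp add: u_hyperplane_def)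
  with v show "v \<in> ?R"
    by blast
next
  fix v assume v: "v \<in> ?R"
  have "u_coord n v p = u_coord n v q" if B: "B \<in> \<pi>" "p \<in> B" "q \<in> B" for B p q
  proof -
    have edge: "u_coord n v x = u_coord n v y" if "x \<in> B" "y \<in> B" "odd x" "even y" "x < y" for x y
    proof -
      have "B \<subseteq> {1..2 * n}"
        using assms B by (auto simp: bond_lattice_Gamma_iff partition_on_def)
      then have "(x, y) \<in> Gamma_edges n"
        using that by (auto simp: Gamma_edges_iff)
      then show ?thesis
        using v B that by (auto simp: u_hyperplane_def)
    qed
    show ?thesis
    proof (cases "\<exists>x. B = {x}")
      case True
      then show ?thesis
        using B by auto
    next
      case False
      then obtain a b where ab: "odd_even_bounds B a b"
        using assms B unfolding bond_lattice_Gamma_iff by blast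
      have "u_coord n v x = u_coord n v a" if x: "x \<in> B" for x
      proof (cases "even x")
        case True
        then have "a \<noteq> x"
          using ab by (auto simp: odd_even_bounds_def)
        then show ?thesis
          using edge[of a x] ab x True by (auto simp: odd_even_bounds_def)
      next
        case False
        then have "a \<noteq> b" "x \<noteq> b"
          using ab by (auto simp: odd_even_bounds_def)
        then show ?thesis
          using edge[of a b] edge[of x b] ab x False by (auto simp: odd_even_bounds_def)
      qed
      with B show ?thesis
        by metis
    qed
  qed
  then show "v \<in> block_flat n \<pi>"
    using v unfolding block_flat_def by blast
qed

text \<open>The blocks of \<open>\<pi>\<close> are the connected components of the graph with edge set \<open>E\<close>.\<close>

lemma ex_block_flat:
  assumes E: "E \<subseteq> Gamma_edges n"
  shows "\<exists>\<pi> \<in> bond_lattice (Gamma n).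
    carrier_vec (2 * n + 2) \<inter> \<Inter> (u_hyperplane n ` E) = block_flat n \<pi>"
proof -
  let ?A = "{1..2 * n}" and ?E = "E \<union> E\<inverse>"
  \<comment> \<open>The reflexive transitive closure relates every number to itself, so it is cut
    down to \<open>?A\<close> to become an equivalence on the vertex set.\<close>
  define r where "r = {(x, y). x \<in> ?A \<and> y \<in> ?A \<and> (x, y) \<in> ?E\<^sup>*}"
  have sym: "sym (?E\<^sup>*)"
    by (intro sym_rtrancl) (auto simp: sym_def)
  have eq: "equiv ?A r"
    unfolding r_def
    by (rule equivI) (auto simp: refl_on_def trans_def intro: rtrancl_trans symI symD[OF sym])
  have edge: "x \<in> ?A \<and> y \<in> ?A \<and> odd x \<and> even y \<and> x < y" if "(x, y) \<in> E" for x y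
    using E that by (auto simp: Gamma_edges_iff)
  have "\<exists>a b. odd_even_bounds B a b" if B: "B \<in> ?A // r" "\<nexists>x. B = {x}" for B
  proof (rule odd_even_boundsI)
    show "B \<noteq> {}"
      using eq B in_quotient_imp_non_empty by blast
    have "B \<subseteq> ?A"
      using eq B in_quotient_imp_subset by blast
    then show "finite B"
      using finite_subset by blast
    \<comment> \<open>The first edge of a path from \<open>x\<close> to another point of its
      component leads to a neighbour in the same component.\<close>
    have nbr: "\<exists>z \<in> B. (x, z) \<in> ?E" if x: "x \<in> B" for x
    proof -
      have "B \<noteq> {x}"
        using B by blast
      then obtain y where y: "y \<in> B" "y \<noteq> x"
        using x by blast
      then have "(x, y) \<in> r"
        using quotient_eq_iff[OF eq B(1) B(1) x y(1)] by simp
      then obtain z where z: "(x, z) \<in> ?E"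
        using y by (auto simp: r_def elim: converse_rtranclE)
      then have "(x, z) \<in> r"
        using edge by (auto simp: r_def)
      then have "z \<in> B"
        using in_quotient_imp_closed[OF eq B(1) x] by blast
      with z show ?thesis
        by blast
    qed
    show "\<exists>y \<in> B. y < x" if "x \<in> B" "even x" for x
      using nbr[OF that(1)] that(2) edge by blast
    show "\<exists>y \<in> B. x < y" if "x \<in> B" "odd x" for x
      using nbr[OF that(1)] that(2) edge by blast
  qed (use B in auto)
  then have bond: "?A // r \<in> bond_lattice (Gamma n)"
    unfolding bond_lattice_Gamma_iff using partition_on_quotient[OF eq] by blast
  have "v \<in> block_flat n (?A // r) \<longleftrightarrow> v \<in> \<Inter> (u_hyperplane n ` E)"
    if v: "v \<in> carrier_vec (2 * n + 2)" for v
  proof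
    assume flat: "v \<in> block_flat n (?A // r)"
    have "u_coord n v x = u_coord n v y" if xy: "(x, y) \<in> E" for x y
    proof -
      have "(x, y) \<in> r" "(x, x) \<in> r"
        using edge[OF xy] xy by (auto simp: r_def)
      moreover have "r `` {x} \<in> ?A // r"
        using edge[OF xy] by (intro quotientI) auto
      ultimately show ?thesis
        using flat unfolding block_flat_def by blast
    qed
    with v show "v \<in> \<Inter> (u_hyperplane n ` E)"
      by (auto simp: u_hyperplane_def)
  next
    assume "v \<in> \<Inter> (u_hyperplane n ` E)"
    then have E_eq: "u_coord n v x = u_coord n v y" if "(x, y) \<in> E" for x y
      using that by (fastforce simp: u_hyperplane_def)
    have "u_coord n v p = u_coord n v q" if B: "B \<in> ?A // r" "p \<in> B" "q \<in> B" for B p q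
    proof -
      have "(p, q) \<in> ?E\<^sup>*"
        using quotient_eq_iff[OF eq B(1) B(1) B(2,3)] by (simp add: r_def)
      then show ?thesis
        by induction (use E_eq in auto)
    qed
    with v show "v \<in> block_flat n (?A // r)"
      unfolding block_flat_def by blast
  qed
  moreover have "block_flat n (?A // r) \<subseteq> carrier_vec (2 * n + 2)"
    by (auto simp: block_flat_def)
  ultimately show ?thesis
    using bond by (intro bexI[of _ "?A // r"]) auto
qed

lemma intersection_lattice_linial:
  "intersection_lattice (carrier_vec (2 * n + 2)) (linial_arrangement n) =
    block_flat n ` bond_lattice (Gamma n)"
proof (intro subset_antisym subsetI)
  fix X assume "X \<in> intersection_lattice (carrier_vec (2 * n + 2)) (linial_arrangement n)"
  then obtain H where H: "H \<subseteq> u_hyperplane n ` Gamma_edges n" "X = carrier_vec (2 * n + 2) \<inter> \<Inter> H"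
    by (auto simp: intersection_lattice_def linial_arrangement_eq)
  then obtain E where "E \<subseteq> Gamma_edges n" "H = u_hyperplane n ` E"
    by (meson subset_imageE)
  then show "X \<in> block_flat n ` bond_lattice (Gamma n)"
    using ex_block_flat[of E n] H(2) by (auto intro: image_eqI)
next
  fix X assume "X \<in> block_flat n ` bond_lattice (Gamma n)"
  then obtain \<pi> where \<pi>: "\<pi> \<in> bond_lattice (Gamma n)" and X: "X = block_flat n \<pi>"
    by blast
  have part: "partition_on {1..2 * n} \<pi>"
    using \<pi> by (simp add: bond_lattice_Gamma_iff)
  \<comment> \<open>\<open>intersection_lattice\<close> discards the empty set; a point with all
    \<open>u_coord\<close> values 0 lies in every flat, so none of them is lost.\<close>
  obtain v where "v \<in> carrier_vec (2 * n + 2)" "\<forall>p \<in> {1..2 * n}. u_coord n v p = 0"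
    using u_coord_surj[of n "\<lambda>_. 0"] by blast
  then have "v \<in> block_flat n \<pi>"
    using partition_onD1[OF part] by (simp add: block_flat_def)
  then have "X \<noteq> {}"
    using X by blast
  moreover have "u_hyperplane n ` {(x, y) \<in> Gamma_edges n. \<exists>B \<in> \<pi>. x \<in> B \<and> y \<in> B} \<subseteq>
      linial_arrangement n"
    by (auto simp: linial_arrangement_eq)
  ultimately show "X \<in> intersection_lattice (carrier_vec (2 * n + 2)) (linial_arrangement n)"
    unfolding X block_flat_eq_Inter[OF \<pi>] intersection_lattice_def by blast
qed

section \<open>Ranks and characteristic polynomials\<close>

text \<open>Choosing a block of \<pi> inside each block of \<tau> is injective. If the choice were
  onto, each block of \<tau> would contain just one block of \<pi> and so equal it.\<close>

lemma card_less_refines: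
  assumes "finite A" and ref: "refines A \<pi> \<tau>" and "\<pi> \<noteq> \<tau>"
  shows "card \<tau> < card \<pi>"
proof -
  have part: "partition_on A \<pi>" "partition_on A \<tau>"
    using ref by (auto simp: refines_def)
  have fin: "finite \<pi>"
    using part(1) \<open>finite A\<close> finite_UnionD unfolding partition_on_def by blast
  have "\<exists>X \<in> \<pi>. X \<subseteq> Y" if "Y \<in> \<tau>" for Y
  proof -
    have "Y \<noteq> {}"
      using that part by (auto simp: partition_on_def)
    then show ?thesis
      using refines_obtains_subset[OF ref that] by (auto simp: partition_on_def)
  qed
  then obtain f where f: "\<And>Y. Y \<in> \<tau> \<Longrightarrow> f Y \<in> \<pi>" "\<And>Y. Y \<in> \<tau> \<Longrightarrow> f Y \<subseteq> Y"
    by metis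
  have below: "Y = Z" if "Y \<in> \<tau>" "Z \<in> \<tau>" "f Z \<subseteq> Y" for Y Z
  proof -
    have "f Z \<noteq> {}"
      using f(1)[OF that(2)] part by (auto simp: partition_on_def)
    then show ?thesis
      using partition_on_block_unique[OF part(2), of Y Z] that f(2)[of Z] by blast
  qed
  have inj: "inj_on f \<tau>"
    using below f by (intro inj_onI) metis
  have "f ` \<tau> \<noteq> \<pi>"
  proof
    assume im: "f ` \<tau> = \<pi>"
    have "f Y = Y" if Y: "Y \<in> \<tau>" for Y
    proof -
      have "{X \<in> \<pi>. X \<subseteq> Y} = {f Y}"
        using im Y below f by blast
      then show ?thesis
        using refines_obtains_subset[OF ref Y] by (simp add: partition_on_def)
    qed
    then show False
      using im \<open>\<pi> \<noteq> \<tau>\<close> by simp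
  qed
  then have "f ` \<tau> \<subset> \<pi>"
    using f by blast
  then show ?thesis
    using card_image[OF inj] fin psubset_card_mono by metis
qed

lemma card_singletons_partition: "card (singletons_partition A) = card A"
  unfolding singletons_partition_def by (simp add: card_image)

lemma card_partition_less:
  assumes "finite A" "partition_on A \<pi>" "\<pi> \<noteq> singletons_partition A"
  shows "card \<pi> < card A"
  using card_less_refines[OF assms(1), of "singletons_partition A" \<pi>] assms
  by (simp add: refines_singletons_partition card_singletons_partition)

text \<open>Removing a point strictly between the least and the greatest element of a block keeps the
  block connected; a block of two elements is split into singletons.\<close>

lemma bond_lattice_Gamma_split:
  assumes \<pi>: "\<pi> \<in> bond_lattice (Gamma n)" and ne: "\<pi> \<noteq> singletons_partition {1..2 * n}"
  shows "\<exists>\<tau> \<in> bond_lattice (Gamma n). refines {1..2 * n} \<tau> \<pi> \<and> card \<tau> = Suc (card \<pi>)"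
proof -
  have part: "partition_on {1..2 * n} \<pi>"
    using \<pi> by (simp add: bond_lattice_Gamma_iff)
  then obtain B where "B \<in> \<pi>" "\<nexists>x. B = {x}"
    using ne eq_singletons_partitionI by blast
  then obtain a b where B: "B \<in> \<pi>" and ab: "odd_even_bounds B a b"
    using \<pi> unfolding bond_lattice_Gamma_iff by blast
  have aB: "a \<in> B" "b \<in> B" "a \<noteq> b"
    using ab by (auto simp: odd_even_bounds_def)
  have "\<exists>x \<in> B. B - {x} = {a} \<or> odd_even_bounds (B - {x}) a b"
  proof (cases "B = {a, b}")
    case True
    then show ?thesis
      using aB by (intro bexI[of _ b]) auto
  next
    case False
    then obtain x where "x \<in> B" "x \<noteq> a" "x \<noteq> b"
      using aB by blast
    then show ?thesis
      using ab by (intro bexI[of _ x]) (auto simp: odd_even_bounds_def)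
  qed
  then obtain x where x: "x \<in> B" "B - {x} = {a} \<or> odd_even_bounds (B - {x}) a b"
    by blast
  then have xB: "B - {x} \<noteq> {}"
    by (auto simp: odd_even_bounds_def)
  define \<tau> where "\<tau> = insert {x} (insert (B - {x}) (\<pi> - {B}))"
  have disj: "C \<inter> B = {}" if "C \<in> \<pi> - {B}" for C
    using partition_on_block_unique[OF part, of C B] that B by blast
  have ne_C: "C \<noteq> {}" if "C \<in> \<pi>" for C
    using part that by (auto simp: partition_on_def)
  have part_\<tau>: "partition_on {1..2 * n} \<tau>"
  proof (rule partition_onI)
    show "\<Union> \<tau> = {1..2 * n}"
      using B x partition_onD1[OF part] by (auto simp: \<tau>_def)
    show "disjnt C D" if "C \<in> \<tau>" "D \<in> \<tau>" "C \<noteq> D" for C D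
      using that disj x partition_on_block_unique[OF part, of C D]
      unfolding \<tau>_def disjnt_def by blast
    show "{} \<notin> \<tau>"
      using xB ne_C by (auto simp: \<tau>_def)
  qed
  have "\<tau> \<in> bond_lattice (Gamma n)"
    unfolding bond_lattice_Gamma_iff
  proof (intro conjI ballI part_\<tau>)
    fix C assume "C \<in> \<tau>"
    then show "(\<exists>y. C = {y}) \<or> (\<exists>a b. odd_even_bounds C a b)"
      using x \<pi> unfolding \<tau>_def bond_lattice_Gamma_iff by blast
  qed
  moreover have "refines {1..2 * n} \<tau> \<pi>"
    using part part_\<tau> B x by (auto simp: refines_def \<tau>_def)
  moreover have "card \<tau> = Suc (card \<pi>)"
  proof -
    have fin: "finite \<pi>"
      using partition_onD1[OF part] by (metis finite_UnionD finite_atLeastAtMost)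
    \<comment> \<open>The two pieces of \<open>B\<close> are new and distinct, so replacing
      \<open>B\<close> by them raises the number of blocks by exactly one.\<close>
    have "B - {x} \<notin> \<pi> - {B}" "{x} \<notin> insert (B - {x}) (\<pi> - {B})"
      using disj[of "B - {x}"] disj[of "{x}"] xB x by auto
    then show ?thesis
      using fin B card_Suc_Diff1[OF fin B] by (simp add: \<tau>_def del: Diff_insert0)
  qed
  ultimately show ?thesis
    by blast
qed

lemma refines_top:
  assumes "partition_on A \<pi>" "A \<noteq> {}"
  shows "refines A \<pi> {A}"
  using assms partition_on_space[OF assms(2)] by (auto simp: refines_def partition_on_def)

lemma top_in_bond_lattice_Gamma:
  assumes "1 \<le> n"
  shows "{{1..2 * n}} \<in> bond_lattice (Gamma n)"
proof -
  have "odd_even_bounds {1..2 * n} 1 (2 * n)"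
    using assms by (auto simp: odd_even_bounds_def)
  then show ?thesis
    using assms partition_on_space[of "{1..2 * n}"] by (auto simp: bond_lattice_Gamma_iff)
qed

section \<open>Moebius values as signed counts of D-permutations\<close>

lemma moebius_bond_lattice_Gamma:
  assumes "\<pi> \<in> bond_lattice (Gamma n)"
  shows "moebius (bond_lattice (Gamma n)) (refines {1..2 * n}) (singletons_partition {1..2 * n}) \<pi> =
    (- 1) ^ card \<pi> * int (card {\<sigma> \<in> D_permutations (2 * n). cycle_support {1..2 * n} \<sigma> = \<pi>})"
proof -
  let ?A = "{1..2 * n}" and ?P = "bond_lattice (Gamma n)" and ?D = "D_permutations (2 * n)"
  let ?s = "singletons_partition ?A"
  let ?g = "\<lambda>\<pi>. (- 1) ^ card \<pi> * int (card {\<sigma> \<in> ?D. cycle_support ?A \<sigma> = \<pi>})"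
  have bot: "refines ?A ?s \<tau>" if "\<tau> \<in> ?P" for \<tau>
    using that by (simp add: refines_singletons_partition bond_lattice_Gamma_iff)
  show ?thesis
  proof (rule moebius_eqI[OF finite_poset_bond_lattice_Gamma singletons_partition_in_bond_lattice])
    have "\<sigma> = id" if \<sigma>: "\<sigma> \<in> ?D" "cycle_support ?A \<sigma> = ?s" for \<sigma>
    proof
      fix x
      have perm: "\<sigma> permutes ?A"
        using \<sigma> by (simp add: D_permutations_def)
      have "refines ?A (cycle_support ?A \<sigma>) ?s"
        using \<sigma>(2) partition_on_singletons_partition refines_refl by metis
      then have "\<forall>B \<in> ?s. \<forall>x \<in> B. \<sigma> x \<in> B"
        using refines_cycle_support_iff[OF _ perm partition_on_singletons_partition] by blast
      then have "\<sigma> x = x" if "x \<in> ?A"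
        using that by (simp add: singletons_partition_def)
      then show "\<sigma> x = id x"
        using perm by (cases "x \<in> ?A") (auto simp: permutes_def)
    qed
    moreover have "id \<in> ?D"
      by (auto simp: D_permutations_def permutes_id)
    moreover have "cycle_support ?A id = ?s"
    proof -
      have "orbit id x = {x}" for x :: nat
        by (simp add: orbit_eq_singleton_iff)
      then show ?thesis
        by (simp add: cycle_support_def singletons_partition_def)
    qed
    ultimately have "{\<sigma> \<in> ?D. cycle_support ?A \<sigma> = ?s} = {id}"
      by blast
    then show "?g ?s = 1"
      by (simp add: card_singletons_partition)
  next
    fix \<tau> assume \<tau>: "\<tau> \<in> ?P" "\<tau> \<noteq> ?s"
    let ?I = "{\<rho> \<in> ?P. refines ?A ?s \<rho> \<and> refines ?A \<rho> \<tau>}"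
    let ?S = "{\<sigma>. \<sigma> \<in> ?D \<and> refines ?A (cycle_support ?A \<sigma>) \<tau>}"
    have "(\<Sum>\<rho> \<in> ?I. ?g \<rho>) =
        (\<Sum>\<rho> \<in> ?I. \<Sum>\<sigma> | \<sigma> \<in> ?S \<and> cycle_support ?A \<sigma> = \<rho>. (- 1) ^ card (cycle_support ?A \<sigma>))"
    proof (rule sum.cong[OF refl])
      fix \<rho> assume "\<rho> \<in> ?I"
      then have "{\<sigma>. \<sigma> \<in> ?S \<and> cycle_support ?A \<sigma> = \<rho>} = {\<sigma> \<in> ?D. cycle_support ?A \<sigma> = \<rho>}"
        by auto
      then show "?g \<rho> =
          (\<Sum>\<sigma> | \<sigma> \<in> ?S \<and> cycle_support ?A \<sigma> = \<rho>. (- 1) ^ card (cycle_support ?A \<sigma>))"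
        by simp
    qed
    \<comment> \<open>No permutation is lost in regrouping by cycle support:
      \<open>cycle_support_D_permutation\<close> puts every support that refines \<tau> into
      \<open>?I\<close>.\<close>
    also have "\<dots> = (\<Sum>\<sigma> \<in> ?S. (- 1) ^ card (cycle_support ?A \<sigma>))"
      using bot cycle_support_D_permutation finite_D_permutations
        finite_posetD(1)[OF finite_poset_bond_lattice_Gamma, of n]
      by (intro sum.group) auto
    also have "\<dots> = 0"
      using \<tau> by (rule sum_D_permutations_refines)
    finally show "(\<Sum>\<rho> \<in> ?I. ?g \<rho>) = 0" .
  qed (use assms bot in auto)
qed

section \<open>Ranks, length and the resulting polynomial\<close>

lemma card_bond_lattice_Gamma:
  assumes "1 \<le> n" "\<pi> \<in> bond_lattice (Gamma n)"
  shows "card \<pi> \<in> {1..2 * n}"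
proof -
  have part: "partition_on {1..2 * n} \<pi>"
    using assms by (simp add: bond_lattice_Gamma_iff)
  have "card \<pi> \<le> 2 * n"
    using card_partition_less[OF _ part] card_singletons_partition[of "{1..2 * n}"]
    by (cases "\<pi> = singletons_partition {1..2 * n}") auto
  moreover have "finite \<pi>"
    using partition_onD1[OF part] by (metis finite_UnionD finite_atLeastAtMost)
  moreover have "\<pi> \<noteq> {}"
    using partition_onD1[OF part] assms(1) by auto
  ultimately show ?thesis
    by (simp add: Suc_le_eq card_gt_0_iff)
qed

lemma poset_rank_bond_lattice_Gamma:
  assumes "\<pi> \<in> bond_lattice (Gamma n)"
  shows "poset_rank (bond_lattice (Gamma n)) (refines {1..2 * n}) \<pi> = 2 * n - card \<pi>"
proof (rule poset_rank_eqI[OF finite_poset_bond_lattice_Gamma _ _ assms])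
  fix \<pi> \<tau> assume \<pi>: "\<pi> \<in> bond_lattice (Gamma n)" "refines {1..2 * n} \<pi> \<tau>" "\<pi> \<noteq> \<tau>"
  then have "card \<tau> < card \<pi>"
    by (intro card_less_refines) auto
  \<comment> \<open>This bound keeps truncated subtraction from hiding the strict increase of the
    rank.\<close>
  moreover have "card \<pi> \<le> 2 * n"
    using \<pi> card_partition_less[of "{1..2 * n}" \<pi>] card_singletons_partition[of "{1..2 * n}"]
    by (cases "\<pi> = singletons_partition {1..2 * n}") (auto simp: bond_lattice_Gamma_iff)
  ultimately show "2 * n - card \<pi> < 2 * n - card \<tau>"
    by simp
next
  fix \<pi> assume \<pi>: "\<pi> \<in> bond_lattice (Gamma n)" "0 < 2 * n - card \<pi>"
  then have "\<pi> \<noteq> singletons_partition {1..2 * n}"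
    using card_singletons_partition[of "{1..2 * n}"] by auto
  with \<pi> show "\<exists>\<tau> \<in> bond_lattice (Gamma n). refines {1..2 * n} \<tau> \<pi> \<and>
      2 * n - card \<pi> = Suc (2 * n - card \<tau>)"
    using bond_lattice_Gamma_split[of \<pi> n] by fastforce
qed

text \<open>For positive \<open>n\<close> the one-block partition is the top, so its ideal is the
  whole lattice and the length is its rank.\<close>

lemma poset_length_bond_lattice_Gamma:
  assumes "1 \<le> n"
  shows "poset_length (bond_lattice (Gamma n)) (refines {1..2 * n}) = 2 * n - 1"
proof -
  let ?P = "bond_lattice (Gamma n)" and ?top = "{{1..2 * n}}"
  have "refines {1..2 * n} \<pi> ?top" if "\<pi> \<in> ?P" for \<pi>
    using that assms by (intro refines_top) (auto simp: bond_lattice_Gamma_iff)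
  then have "{\<pi> \<in> ?P. refines {1..2 * n} \<pi> ?top} = ?P"
    by blast
  then show ?thesis
    using poset_rank_bond_lattice_Gamma[OF top_in_bond_lattice_Gamma[OF assms]]
    by (simp add: poset_rank_def)
qed

text \<open>Double counting over the fibres of \<open>f\<close>. It is applied with \<open>f\<close>
  the cycle support, to pass from partitions to D-permutations, and then with \<open>f\<close> the
  number of cycles, to collect powers.\<close>

lemma sum_monom_fibres:
  fixes c :: "'b \<Rightarrow> int"
  assumes "finite S" "finite T" "f ` S \<subseteq> T"
  shows "(\<Sum>t \<in> T. Polynomial.monom (c t * int (card {x \<in> S. f x = t})) (d t)) =
    (\<Sum>x \<in> S. Polynomial.monom (c (f x)) (d (f x)))"
proof -
  have const: "(\<Sum>x \<in> U. Polynomial.monom a m) = Polynomial.monom (a * int (card U)) m"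
    for a :: int and m and U :: "'a set"
    by (induction U rule: infinite_finite_induct)
      (simp_all add: add_monom algebra_simps)
  have "(\<Sum>t \<in> T. Polynomial.monom (c t * int (card {x \<in> S. f x = t})) (d t)) =
      (\<Sum>t \<in> T. \<Sum>x | x \<in> S \<and> f x = t. Polynomial.monom (c (f x)) (d (f x)))"
    unfolding const[symmetric] by (intro sum.cong) auto
  also have "\<dots> = (\<Sum>x \<in> S. Polynomial.monom (c (f x)) (d (f x)))"
    using assms by (rule sum.group)
  finally show ?thesis .
qed

lemma characteristic_poly_bond_lattice_Gamma:
  assumes n: "1 \<le> n"
  shows "characteristic_poly (bond_lattice (Gamma n)) (refines {1..2 * n}) =
    (\<Sum>k = 1..2 * n. Polynomial.monom (s_D (2 * n) k) (k - 1))"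
proof -
  let ?A = "{1..2 * n}" and ?P = "bond_lattice (Gamma n)" and ?D = "D_permutations (2 * n)"
  note P = finite_poset_bond_lattice_Gamma[of n]
  have bot: "poset_bot ?P (refines ?A) = singletons_partition ?A"
    by (rule poset_bot_eqI[OF P singletons_partition_in_bond_lattice])
      (simp add: refines_singletons_partition bond_lattice_Gamma_iff)
  have "characteristic_poly ?P (refines ?A) =
      (\<Sum>\<pi> \<in> ?P. Polynomial.monom
        ((- 1) ^ card \<pi> * int (card {\<sigma> \<in> ?D. cycle_support ?A \<sigma> = \<pi>})) (card \<pi> - 1))"
    unfolding characteristic_poly_def bot poset_length_bond_lattice_Gamma[OF n]
  proof (rule sum.cong[OF refl])
    fix \<pi> assume \<pi>: "\<pi> \<in> ?P"
    \<comment> \<open>All subtractions are exact here, since \<pi> has between 1 and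
      \<open>2 * n\<close> blocks.\<close>
    have "2 * n - 1 - (2 * n - card \<pi>) = card \<pi> - 1"
      using card_bond_lattice_Gamma[OF n \<pi>] by auto
    then show "Polynomial.monom (moebius ?P (refines ?A) (singletons_partition ?A) \<pi>)
          (2 * n - 1 - poset_rank ?P (refines ?A) \<pi>) =
        Polynomial.monom ((- 1) ^ card \<pi> * int (card {\<sigma> \<in> ?D. cycle_support ?A \<sigma> = \<pi>})) (card \<pi> - 1)"
      using \<pi> by (simp only: moebius_bond_lattice_Gamma poset_rank_bond_lattice_Gamma)
  qed
  also have "\<dots> = (\<Sum>\<sigma> \<in> ?D. Polynomial.monom
      ((- 1) ^ card (cycle_support ?A \<sigma>)) (card (cycle_support ?A \<sigma>) - 1))"
    using finite_D_permutations finite_posetD(1)[OF P] cycle_support_D_permutation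
    by (intro sum_monom_fibres) auto
  also have "\<dots> = (\<Sum>k = 1..2 * n. Polynomial.monom
      ((- 1) ^ k * int (card {\<sigma> \<in> ?D. card (cycle_support ?A \<sigma>) = k})) (k - 1))"
    using finite_D_permutations card_bond_lattice_Gamma[OF n cycle_support_D_permutation]
    by (intro sum_monom_fibres[symmetric]) auto
  finally show ?thesis
    by (simp add: s_D_def)
qed

text \<open>\<open>block_flat n\<close> is an isomorphism from the bond lattice onto the
  intersection lattice: a coarser partition imposes more equations and gives a smaller flat.\<close>

lemma characteristic_poly_linial:
  "characteristic_poly (intersection_lattice (carrier_vec (2 * n + 2)) (linial_arrangement n)) (\<supseteq>) =
    characteristic_poly (bond_lattice (Gamma n)) (refines {1..2 * n})"
proof -
  let ?P = "bond_lattice (Gamma n)"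
  have part: "partition_on {1..2 * n} \<pi>" if "\<pi> \<in> ?P" for \<pi>
    using that by (simp add: bond_lattice_Gamma_iff)
  have "finite (Gamma_edges n)"
    by (rule finite_subset[of _ "{1..2 * n} \<times> {1..2 * n}"]) (auto simp: Gamma_edges_iff)
  then have "finite (linial_arrangement n)"
    by (simp add: linial_arrangement_eq)
  then have Q: "finite_poset (block_flat n ` ?P) (\<supseteq>)"
    using finite_poset_intersection_lattice intersection_lattice_linial by metis
  have "inj_on (block_flat n) ?P"
    using block_flat_subset_iff part by (intro inj_onI) (metis order_refl refines_asym)
  then show ?thesis
    unfolding intersection_lattice_linial
    using finite_poset_bond_lattice_Gamma Q singletons_partition_in_bond_lattice part
    by (intro characteristic_poly_iso[where b = "singletons_partition {1..2 * n}"])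
      (auto simp: block_flat_subset_iff refines_singletons_partition)
qed

theorem theorem3p5:
  fixes n :: nat
  assumes "n \<ge> 1"
  shows "(\<forall>\<pi> \<in> bond_lattice (Gamma n).
            (- 1) ^ card \<pi> *
              moebius (bond_lattice (Gamma n)) (refines {1..2 * n})
                (singletons_partition {1..2 * n}) \<pi>
            = int (card {\<sigma> \<in> D_permutations (2 * n). cycle_support {1..2 * n} \<sigma> = \<pi>}))
       \<and> characteristic_poly
            (intersection_lattice (carrier_vec (2 * n + 2)) (linial_arrangement n)) (\<supseteq>)
          = (\<Sum>k = 1..2 * n. Polynomial.monom (s_D (2 * n) k) (k - 1))"
proof (intro conjI ballI)
  fix \<pi> assume \<pi>: "\<pi> \<in> bond_lattice (Gamma n)"
  have "(- 1) ^ card \<pi> * ((- 1) ^ card \<pi> * c) = c" for c :: int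
    by (simp flip: mult.assoc power_mult_distrib)
  then show "(- 1) ^ card \<pi> *
      moebius (bond_lattice (Gamma n)) (refines {1..2 * n}) (singletons_partition {1..2 * n}) \<pi> =
    int (card {\<sigma> \<in> D_permutations (2 * n). cycle_support {1..2 * n} \<sigma> = \<pi>})"
    unfolding moebius_bond_lattice_Gamma[OF \<pi>] .
next
  show "characteristic_poly
      (intersection_lattice (carrier_vec (2 * n + 2)) (linial_arrangement n)) (\<supseteq>) =
    (\<Sum>k = 1..2 * n. Polynomial.monom (s_D (2 * n) k) (k - 1))"
    unfolding characteristic_poly_linial using assms by (rule characteristic_poly_bond_lattice_Gamma)
qed

end
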